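(* Let $d\in\{3,4,6\}$ and let $\mathcal{E}_k=\{k+dj : j\in\mathbb{N}_0\}$ for $0\le k\le d-1$. Let $f\in F^2$. If there exists a point $\beta\in\mathbb{C}$ such that $$f^{(j)}(0)=0 \quad\text{for all } j\in\mathcal{E}_0,$$ and $$(U_\beta f)^{(j)}(0)=0\quad\text{for all } j\in\mathcal{E}_k \text{ and all } 1\le k\le d-1,$$ then $f=0$.
   Context: $\mathbb{N}_0=\{0,1,2,\dots\}$. The Fock space $F^2$ is the Hilbert space of all entire functions $f$ on $\mathbb{C}$ with $\|f\|^2=\int_{\mathbb{C}}|f(z)|^2e^{-|z|^2}\,\mathrm{d}A(z)<\infty$, where $\mathrm{d}A(z)=\pi^{-1}\mathrm{d}x\,\mathrm{d}y$, $z=x+iy$. For $\alpha\in\mathbb{C}$, the Weyl operator $U_\alpha:F^2\to F^2$ is the unitary operator defined by $U_\alpha f(z)=e^{-\frac12|\alpha|^2-\overline{\alpha}z}f(z+\alpha)$. $f^{(j)}$ denotes the $j$-th complex derivative, with $f^{(0)}=f$. *)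

theory Defs
  imports "HOL-Analysis.Analysis"
begin

definition area_measure :: "complex measure" where
  "area_measure = scale_measure (ennreal (1 / pi)) lborel"

text \<open>The squared Fock norm takes values in \<^typ>\<open>ennreal\<close>, so that finiteness is a genuine condition.\<close>

definition fock_norm_sq :: "(complex \<Rightarrow> complex) \<Rightarrow> ennreal" where
  "fock_norm_sq f =
     (\<integral>\<^sup>+ z. ennreal ((cmod (f z))\<^sup>2 * exp (- (cmod z)\<^sup>2)) \<partial>area_measure)"

definition fock_space :: "(complex \<Rightarrow> complex) set" where
  "fock_space = {f. f holomorphic_on UNIV \<and> fock_norm_sq f < \<infinity>}"

definition weyl :: "complex \<Rightarrow> (complex \<Rightarrow> complex) \<Rightarrow> complex \<Rightarrow> complex" where
  "weyl \<alpha> f = (\<lambda>z. exp (- (1 / 2) * of_real ((cmod \<alpha>)\<^sup>2) - cnj \<alpha> * z) * f (z + \<alpha>))"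

definition progression :: "nat \<Rightarrow> nat \<Rightarrow> nat set" where
  "progression d k = {k + d * j | j. True}"

end

theory Submission
  imports Defs "HOL-Complex_Analysis.Cauchy_Integral_Formula"
begin

text \<open>
  Let \<open>\<omega>\<close> be a primitive \<open>d\<close>-th root of unity. The conditions say that \<open>g = U\<^sub>\<beta> f\<close> is invariant under
  the rotation by \<open>\<omega>\<close> and that the rotates of \<open>f\<close> sum to \<open>0\<close>. Together they give a linear relation between
  the Weyl translates of \<open>g\<close> by the orbit of \<open>\<beta>\<close> under rotation, which lies in a lattice exactly
  because \<open>d\<close> is 3, 4 or 6 (for \<open>\<beta> \<noteq> 0\<close>).

  Translates of a nonzero square-integrable function along a lattice are independent (Linnell's
  theorem), by the following dimension count. On an \<open>n \<times> n\<close> box of the lattice the relation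
  determines every solution from its values on a boundary layer of \<open>O(n)\<close> points. Hence the
  \<open>n\<^sup>2 \<times> n\<^sup>2\<close> matrix whose rows are the phase-corrected translates of \<open>G(z) = g(z) exp(-|z|\<^sup>2/2)\<close>
  has rank \<open>O(n)\<close>, while its trace is \<open>n\<^sup>2 G(z)\<close>. Since the squared trace is at most the rank times
  the squared Hilbert-Schmidt norm, averaging over \<open>z\<close> in a small ball \<open>D\<close> bounds
  \<open>n \<integral>\<^sub>D |G|\<^sup>2\<close> by a constant multiple of \<open>\<integral> |G|\<^sup>2\<close>, for every large \<open>n\<close>.
\<close>

section \<open>Rank and trace\<close>

lemma sum_product_assoc:
  fixes a :: "'y \<Rightarrow> 'a::comm_semiring_0"
  shows "(\<Sum>y\<in>Y. a y * (\<Sum>z\<in>Z. b y z * c z)) = (\<Sum>z\<in>Z. (\<Sum>y\<in>Y. a y * b y z) * c z)"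
  by (simp add: sum_distrib_left sum_distrib_right mult.assoc) (rule sum.swap)

text \<open>Gram-Schmidt, one vector at a time. \<open>p\<close> is the matrix of the orthogonal
  projection of the functions on \<open>X\<close> onto the span of the \<open>v k\<close>; its trace
  is a dimension, hence at most the number of vectors.\<close>

lemma projection_kernel_onto_span:
  fixes v :: "'k \<Rightarrow> 'x \<Rightarrow> complex"
  assumes "finite K" "finite X"
  shows "\<exists>p. (\<forall>x y. p y x = cnj (p x y)) \<and>
             (\<forall>x\<in>X. \<forall>z\<in>X. (\<Sum>y\<in>X. p x y * p y z) = p x z) \<and>
             (\<forall>k\<in>K. \<forall>x\<in>X. (\<Sum>y\<in>X. p x y * v k y) = v k x) \<and>
             (\<Sum>x\<in>X. Re (p x x)) \<le> real (card K)"
  using assms(1)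
proof (induction K rule: finite_induct)
  case empty
  show ?case by (rule exI[of _ "\<lambda>x y. 0"]) auto
next
  case (insert k K)
  then obtain p where herm: "\<And>x y. p y x = cnj (p x y)"
    and idem: "\<And>x z. x \<in> X \<Longrightarrow> z \<in> X \<Longrightarrow> (\<Sum>y\<in>X. p x y * p y z) = p x z"
    and fx: "\<And>j x. j \<in> K \<Longrightarrow> x \<in> X \<Longrightarrow> (\<Sum>y\<in>X. p x y * v j y) = v j x"
    and tr: "(\<Sum>x\<in>X. Re (p x x)) \<le> real (card K)"
    by blast
  \<comment> \<open>The component of the new vector orthogonal to the old span; \<open>pr\<close>
    and \<open>rp\<close> record that \<open>p\<close> annihilates it from both sides.\<close>
  define r where "r x = v k x - (\<Sum>y\<in>X. p x y * v k y)" for x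
  define N where "N = (\<Sum>x\<in>X. (cmod (r x))\<^sup>2)"
  have pr: "(\<Sum>y\<in>X. p x y * r y) = 0" if "x \<in> X" for x
  proof -
    have "(\<Sum>y\<in>X. p x y * (\<Sum>z\<in>X. p y z * v k z)) = (\<Sum>z\<in>X. (\<Sum>y\<in>X. p x y * p y z) * v k z)"
      by (rule sum_product_assoc)
    also have "\<dots> = (\<Sum>z\<in>X. p x z * v k z)"
      using idem that by (intro sum.cong) auto
    finally show ?thesis
      by (simp add: r_def right_diff_distrib sum_subtractf)
  qed
  have rp: "(\<Sum>y\<in>X. cnj (r y) * p y x) = 0" if "x \<in> X" for x
  proof -
    have "(\<Sum>y\<in>X. cnj (r y) * p y x) = cnj (\<Sum>y\<in>X. p x y * r y)"
      by (simp add: herm[of x] mult.commute)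
    then show ?thesis using pr[OF that] by simp
  qed
  show ?case
  proof (cases "N = 0")
    case True
    then have "r x = 0" if "x \<in> X" for x
      using that assms(2) by (simp add: N_def sum_nonneg_eq_0_iff)
    then have "(\<Sum>y\<in>X. p x y * v k y) = v k x" if "x \<in> X" for x
      using that by (simp add: r_def)
    then have "(\<Sum>y\<in>X. p x y * v j y) = v j x" if "j \<in> insert k K" "x \<in> X" for j x
      using that fx by blast
    moreover have "(\<Sum>x\<in>X. Re (p x x)) \<le> real (card (insert k K))"
      using tr insert.hyps by simp
    ultimately show ?thesis
      using herm idem by blast
  next
    case False
    have rr: "(\<Sum>y\<in>X. cnj (r y) * r y) = of_real N"
      unfolding N_def of_real_sum
      by (intro sum.cong) (simp_all add: complex_norm_square mult.commute del: of_real_power)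
    \<comment> \<open>Adds the rank-one projection onto the line through \<open>r\<close>, which
      raises the trace by exactly 1.\<close>
    define q where "q x y = p x y + r x * cnj (r y) / of_real N" for x y
    have q_apply: "(\<Sum>y\<in>X. q x y * u y) = (\<Sum>y\<in>X. p x y * u y) + r x * (\<Sum>y\<in>X. cnj (r y) * u y) / of_real N"
      for x u
      by (simp add: q_def distrib_right sum.distrib sum_distrib_left sum_divide_distrib mult.assoc)
    have "q y x = cnj (q x y)" for x y
      by (simp add: q_def herm[of x y])
    moreover have "(\<Sum>y\<in>X. q x y * q y z) = q x z" if "x \<in> X" "z \<in> X" for x z
    proof -
      have "(\<Sum>y\<in>X. p x y * q y z) = p x z + (\<Sum>y\<in>X. p x y * r y) * cnj (r z) / of_real N"
        by (simp add: q_def distrib_left sum.distrib idem that sum_distrib_right sum_divide_distrib mult.assoc)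
      moreover have "(\<Sum>y\<in>X. cnj (r y) * q y z) =
          (\<Sum>y\<in>X. cnj (r y) * p y z) + (\<Sum>y\<in>X. cnj (r y) * r y) * cnj (r z) / of_real N"
        by (simp add: q_def distrib_left sum.distrib sum_distrib_right sum_divide_distrib mult.assoc)
      ultimately show ?thesis
        using False by (simp add: q_apply pr rp rr that) (simp add: q_def)
    qed
    moreover have "(\<Sum>y\<in>X. q x y * v j y) = v j x" if "j \<in> insert k K" "x \<in> X" for j x
    proof -
      \<comment> \<open>One orthogonal splitting serves old and new vectors: old ones are already
        fixed by \<open>p\<close>, and only \<open>v k\<close> has a component along
        \<open>r\<close>.\<close>
      have pv: "v j y = (if j = k then r y else 0) + (\<Sum>z\<in>X. p y z * v j z)" if "y \<in> X" for y
        using \<open>j \<in> insert k K\<close> that fx[of j y] insert.hyps by (auto simp: r_def)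
      have "(\<Sum>y\<in>X. cnj (r y) * (\<Sum>z\<in>X. p y z * v j z)) = (\<Sum>z\<in>X. (\<Sum>y\<in>X. cnj (r y) * p y z) * v j z)"
        by (rule sum_product_assoc)
      also have "\<dots> = 0"
        using rp by simp
      finally have 0: "(\<Sum>y\<in>X. cnj (r y) * (\<Sum>z\<in>X. p y z * v j z)) = 0" .
      have "(\<Sum>y\<in>X. cnj (r y) * v j y) =
          (\<Sum>y\<in>X. cnj (r y) * ((if j = k then r y else 0) + (\<Sum>z\<in>X. p y z * v j z)))"
        by (intro sum.cong refl arg_cong2[of _ _ _ _ "(*)"] pv)
      also have "\<dots> = (if j = k then of_real N else 0)"
        using rr 0 by (simp add: distrib_left sum.distrib)
      finally show ?thesis
        using pv[OF that(2)] False by (cases "j = k") (simp_all add: q_apply)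
    qed
    moreover have "(\<Sum>x\<in>X. Re (q x x)) \<le> real (card (insert k K))"
    proof -
      have "Re (r x * cnj (r x) / of_real N) = (cmod (r x))\<^sup>2 / N" for x
        by (metis Re_complex_of_real complex_norm_square of_real_divide)
      then have "(\<Sum>x\<in>X. Re (q x x)) = (\<Sum>x\<in>X. Re (p x x)) + N / N"
        unfolding q_def plus_complex.sel sum.distrib N_def sum_divide_distrib by (simp only:)
      then show ?thesis
        using tr False insert.hyps by simp
    qed
    ultimately show ?thesis by blast
  qed
qed

text \<open>The rows of \<open>M\<close> lie in the span of the \<open>v k\<close>, so the
  projection \<open>p\<close> onto it fixes them and the trace becomes a Hilbert-Schmidt pairing of
  \<open>p\<close> with \<open>M\<close>. Cauchy-Schwarz finishes, since the squared Hilbert-Schmidt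
  norm of \<open>p\<close> equals its trace.\<close>

lemma trace_sq_le_rank_times_Hilbert_Schmidt:
  fixes M :: "'x \<Rightarrow> 'x \<Rightarrow> complex"
  assumes "finite K" "finite X"
    and M: "\<And>x y. x \<in> X \<Longrightarrow> y \<in> X \<Longrightarrow> M x y = (\<Sum>k\<in>K. a x k * v k y)"
  shows "(cmod (\<Sum>x\<in>X. M x x))\<^sup>2 \<le> real (card K) * (\<Sum>x\<in>X. \<Sum>y\<in>X. (cmod (M x y))\<^sup>2)"
proof -
  obtain p where herm: "\<And>x y. p y x = cnj (p x y)"
    and idem: "\<And>x z. x \<in> X \<Longrightarrow> z \<in> X \<Longrightarrow> (\<Sum>y\<in>X. p x y * p y z) = p x z"
    and fx: "\<And>k x. k \<in> K \<Longrightarrow> x \<in> X \<Longrightarrow> (\<Sum>y\<in>X. p x y * v k y) = v k x"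
    and tr: "(\<Sum>x\<in>X. Re (p x x)) \<le> real (card K)"
    using projection_kernel_onto_span[OF assms(1,2), of v] by blast
  have "complex_of_real (\<Sum>y\<in>X. (cmod (p x y))\<^sup>2) = p x x" if "x \<in> X" for x
    unfolding of_real_sum idem[OF that that, symmetric]
    by (intro sum.cong) (simp_all add: complex_norm_square herm[of x] del: of_real_power)
  then have "(\<Sum>y\<in>X. (cmod (p x y))\<^sup>2) = Re (p x x)" if "x \<in> X" for x
    using that by (metis Re_complex_of_real)
  then have HS: "(\<Sum>x\<in>X. \<Sum>y\<in>X. (cmod (p x y))\<^sup>2) \<le> real (card K)"
    using tr by simp
  have "M x x = (\<Sum>y\<in>X. p x y * M x y)" if "x \<in> X" for x
  proof -
    have "(\<Sum>y\<in>X. p x y * M x y) = (\<Sum>y\<in>X. \<Sum>k\<in>K. a x k * (p x y * v k y))"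
      using M that by (intro sum.cong) (auto simp: sum_distrib_left algebra_simps)
    also have "\<dots> = (\<Sum>k\<in>K. a x k * (\<Sum>y\<in>X. p x y * v k y))"
      by (subst sum.swap) (simp add: sum_distrib_left)
    also have "\<dots> = M x x"
      using fx M that by simp
    finally show ?thesis ..
  qed
  then have "cmod (\<Sum>x\<in>X. M x x) = cmod (\<Sum>z\<in>X\<times>X. p (fst z) (snd z) * M (fst z) (snd z))"
    by (simp add: sum.cartesian_product split_def)
  also have "\<dots> \<le> (\<Sum>z\<in>X\<times>X. cmod (p (fst z) (snd z)) * cmod (M (fst z) (snd z)))"
    by (rule sum_norm_le) (simp add: norm_mult)
  finally have "(cmod (\<Sum>x\<in>X. M x x))\<^sup>2 \<le> (\<Sum>z\<in>X\<times>X. cmod (p (fst z) (snd z)) * cmod (M (fst z) (snd z)))\<^sup>2"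
    by (intro power_mono) auto
  also have "\<dots> \<le> (\<Sum>z\<in>X\<times>X. (cmod (p (fst z) (snd z)))\<^sup>2) * (\<Sum>z\<in>X\<times>X. (cmod (M (fst z) (snd z)))\<^sup>2)"
    by (rule Cauchy_Schwarz_ineq_sum)
  also have "\<dots> \<le> real (card K) * (\<Sum>z\<in>X\<times>X. (cmod (M (fst z) (snd z)))\<^sup>2)"
    using HS by (intro mult_right_mono sum_nonneg) (auto simp: sum.cartesian_product split_def)
  finally show ?thesis
    by (simp add: sum.cartesian_product split_def)
qed

section \<open>Finite-range recurrences on the plane lattice\<close>

text \<open>Outside the boundary layer the relation expresses \<open>u x\<close> through values at
  points of the box that come earlier in a linear order, so induction reaches the layer. The
  coefficients \<open>C\<close> do not depend on \<open>u\<close>, which is what bounds a rank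
  later.\<close>

lemma solutions_determined_on_boundary:
  fixes s :: "'i \<Rightarrow> int \<times> int" and e :: "'i \<Rightarrow> int \<times> int \<Rightarrow> complex" and R n :: int
  assumes I: "finite I" "I \<noteq> {}" and inj: "inj_on s I"
    and R: "\<And>i. i \<in> I \<Longrightarrow> \<bar>fst (s i)\<bar> \<le> R \<and> \<bar>snd (s i)\<bar> \<le> R"
    and e: "\<And>i x. i \<in> I \<Longrightarrow> e i x \<noteq> 0"
    and X: "X = {0..<n} \<times> {0..<n}"
    and B: "B = X - {2 * R..<n - 2 * R} \<times> {2 * R..<n - 2 * R}"
  shows "\<exists>C. \<forall>u. (\<forall>x. (\<Sum>i\<in>I. e i x * u (x - s i)) = 0) \<longrightarrow> (\<forall>x\<in>X. u x = (\<Sum>b\<in>B. C x b * u b))"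
proof -
  define P where "P u \<longleftrightarrow> (\<forall>x. (\<Sum>i\<in>I. e i x * u (x - s i)) = 0)" for u
  \<comment> \<open>The weight makes \<open>l\<close> injective on the range of \<open>s\<close>, so the relation can be solved for the
    value at the \<open>l\<close>-largest point it involves.\<close>
  define l where "l x = (2 * R + 1) * fst x + snd x" for x :: "int \<times> int"
  have R0: "0 \<le> R" using I R by fastforce
  have fin: "finite B" using X B by auto
  obtain i0 where i0: "i0 \<in> I" and min: "\<And>i. i \<in> I \<Longrightarrow> l (s i0) \<le> l (s i)"
    using ex_is_arg_min_if_finite[OF I, of "l \<circ> s"] by (auto simp: is_arg_min_linorder)
  have strict: "l (s i0) < l (s i)" if i: "i \<in> I" "i \<noteq> i0" for i
  proof (rule ccontr)
    assume "\<not> ?thesis"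
    then have eq: "l (s i0) = l (s i)" using min i by force
    define A where "A = fst (s i) - fst (s i0)"
    have *: "(2 * R + 1) * A = snd (s i0) - snd (s i)"
      using eq by (simp add: l_def A_def algebra_simps)
    \<comment> \<open>The second coordinates differ by at most \<open>2 * R\<close>, too little to
      compensate any nonzero difference \<open>A\<close> of the first ones.\<close>
    have small: "\<bar>(2 * R + 1) * A\<bar> < 2 * R + 1"
      using R[OF i0] R[OF i(1)] unfolding * by linarith
    have "A = 0"
    proof (rule ccontr)
      assume "A \<noteq> 0"
      then have "(2 * R + 1) * 1 \<le> (2 * R + 1) * \<bar>A\<bar>"
        using R0 by (intro mult_left_mono) auto
      also have "\<dots> = \<bar>(2 * R + 1) * A\<bar>"
        using R0 by (simp add: abs_mult)
      finally show False using small by simp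
    qed
    then have "s i = s i0"
      using * by (simp add: A_def prod_eq_iff)
    then show False using inj i i0 by (auto dest: inj_onD)
  qed
  have "\<exists>c. \<forall>u. P u \<longrightarrow> u x = (\<Sum>b\<in>B. c b * u b)" if "x \<in> X" for x
    using that
  proof (induction "nat (l x)" arbitrary: x rule: less_induct)
    case less
    show ?case
    proof (cases "x \<in> B")
      case True
      then show ?thesis
        using fin by (intro exI[of _ "\<lambda>b. of_bool (b = x)"]) (simp add: of_bool_def if_distrib[of "\<lambda>t. t * _"] cong: if_cong)
    next
      case False
      then have int: "x \<in> {2 * R..<n - 2 * R} \<times> {2 * R..<n - 2 * R}"
        using less.prems B by blast
      \<comment> \<open>Centred at \<open>y\<close>, the relation involves \<open>u x\<close>
        through the index \<open>i0\<close>; every other index gives a point with smaller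
        \<open>l\<close>.\<close>
      define y where "y = x + s i0"
      have "\<exists>c. \<forall>u. P u \<longrightarrow> u (y - s i) = (\<Sum>b\<in>B. c b * u b)" if i: "i \<in> I - {i0}" for i
      proof -
        \<comment> \<open>The point is \<open>x + s i0 - s i\<close>, at most \<open>2 * R\<close>
          away from \<open>x\<close> in each coordinate: this fixes the width of the layer.\<close>
        have X': "y - s i \<in> X"
          using int R[OF i0] R[of i] i unfolding X y_def mem_Times_iff by auto
        then have "0 \<le> l (y - s i)"
          using R0 unfolding l_def X mem_Times_iff by (intro add_nonneg_nonneg mult_nonneg_nonneg) auto
        moreover have "l (y - s i) < l x"
          using strict[of i] i by (simp add: l_def y_def algebra_simps)
        ultimately have "nat (l (y - s i)) < nat (l x)" by linarith
        then show ?thesis using less.hyps X' by blast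
      qed
      then obtain c where c: "\<And>i u. i \<in> I - {i0} \<Longrightarrow> P u \<Longrightarrow> u (y - s i) = (\<Sum>b\<in>B. c i b * u b)"
        by metis
      define d where "d b = (\<Sum>i\<in>I - {i0}. - (e i y / e i0 y) * c i b)" for b
      have "u x = (\<Sum>b\<in>B. d b * u b)" if u: "P u" for u
      proof -
        have "0 = (\<Sum>i\<in>I. e i y * u (y - s i))" using u[unfolded P_def, rule_format, of y] by (rule sym)
        also have "\<dots> = e i0 y * u x + (\<Sum>i\<in>I - {i0}. e i y * u (y - s i))"
          using i0 I by (simp add: sum.remove y_def)
        finally have "e i0 y * u x = - (\<Sum>i\<in>I - {i0}. e i y * u (y - s i))"
          by (simp add: add_eq_0_iff2)
        then have "u x = - (\<Sum>i\<in>I - {i0}. e i y * u (y - s i)) / e i0 y"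
          using e[OF i0] by (simp add: field_simps)
        also have "\<dots> = (\<Sum>i\<in>I - {i0}. \<Sum>b\<in>B. - (e i y / e i0 y) * c i b * u b)"
          unfolding sum_negf[symmetric] sum_divide_distrib
          by (rule sum.cong) (simp_all add: c[OF _ u] sum_distrib_left sum_divide_distrib sum_negf mult.assoc)
        also have "\<dots> = (\<Sum>b\<in>B. d b * u b)"
          by (subst sum.swap) (simp add: d_def sum_distrib_right)
        finally show ?thesis .
      qed
      then show ?thesis by blast
    qed
  qed
  then obtain C where "\<And>x u. x \<in> X \<Longrightarrow> P u \<Longrightarrow> u x = (\<Sum>b\<in>B. C x b * u b)"
    by metis
  then show ?thesis
    unfolding P_def[symmetric] by blast
qed

section \<open>Independence of twisted lattice translates\<close>

definition lattice_point :: "complex \<Rightarrow> complex \<Rightarrow> int \<times> int \<Rightarrow> complex" where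
  "lattice_point \<beta> \<gamma> x = of_int (fst x) * \<beta> + of_int (snd x) * \<gamma>"

lemma lattice_point_diff:
  "lattice_point \<beta> \<gamma> (x - y) = lattice_point \<beta> \<gamma> x - lattice_point \<beta> \<gamma> y"
  by (simp add: lattice_point_def algebra_simps)

text \<open>A nonzero lattice vector is either a nonzero integer multiple of \<beta>, or lies at
  distance at least \<open>\<bar>Im (cnj \<beta> * \<gamma>)\<bar> / cmod \<beta>\<close> from the
  line through 0 and \<beta>.\<close>

lemma lattice_separated:
  assumes indep: "Im (cnj \<beta> * \<gamma>) \<noteq> 0"
  obtains \<delta> where "\<delta> > 0"
    "\<And>x y. x \<noteq> y \<Longrightarrow> \<delta> \<le> cmod (lattice_point \<beta> \<gamma> x - lattice_point \<beta> \<gamma> y)"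
proof
  let ?t = "\<bar>Im (cnj \<beta> * \<gamma>)\<bar>"
  have \<beta>: "cmod \<beta> > 0" using indep by auto
  then show "min (cmod \<beta>) (?t / cmod \<beta>) > 0" using indep by simp
  fix x y :: "int \<times> int" assume "x \<noteq> y"
  define z where "z = x - y"
  then have "z \<noteq> 0" using \<open>x \<noteq> y\<close> by simp
  have "min (cmod \<beta>) (?t / cmod \<beta>) \<le> cmod (lattice_point \<beta> \<gamma> z)"
  proof (cases "snd z = 0")
    case True
    then have "1 \<le> real_of_int \<bar>fst z\<bar>" using \<open>z \<noteq> 0\<close> by (auto simp: prod_eq_iff)
    then have "1 * cmod \<beta> \<le> real_of_int \<bar>fst z\<bar> * cmod \<beta>"
      by (intro mult_right_mono) auto
    then show ?thesis using True by (simp add: lattice_point_def norm_mult)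
  next
    case False
    have "Im (cnj \<beta> * lattice_point \<beta> \<gamma> z) = of_int (snd z) * Im (cnj \<beta> * \<gamma>)"
      by (simp add: lattice_point_def algebra_simps)
    then have "real_of_int \<bar>snd z\<bar> * ?t = \<bar>Im (cnj \<beta> * lattice_point \<beta> \<gamma> z)\<bar>"
      by (simp add: abs_mult)
    also have "\<dots> \<le> cmod (cnj \<beta> * lattice_point \<beta> \<gamma> z)"
      by (rule abs_Im_le_cmod)
    also have "\<dots> = cmod (lattice_point \<beta> \<gamma> z) * cmod \<beta>"
      by (simp add: norm_mult)
    finally have "real_of_int \<bar>snd z\<bar> * ?t \<le> cmod (lattice_point \<beta> \<gamma> z) * cmod \<beta>" .
    moreover have "1 * ?t \<le> real_of_int \<bar>snd z\<bar> * ?t"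
      using False by (intro mult_right_mono) linarith+
    ultimately show ?thesis
      using \<beta> by (simp add: min_le_iff_disj pos_divide_le_eq)
  qed
  then show "min (cmod \<beta>) (?t / cmod \<beta>) \<le> cmod (lattice_point \<beta> \<gamma> x - lattice_point \<beta> \<gamma> y)"
    by (simp add: z_def lattice_point_diff)
qed

text \<open>This is the trace inequality for a matrix with constant diagonal \<open>G z\<close> (up
  to phases, its entries are the values \<open>G (z + L y - L x)\<close>) and with rank at most the
  size of the boundary layer.\<close>

lemma box_inequality:
  fixes G :: "complex \<Rightarrow> complex" and c :: "'i \<Rightarrow> complex" and s :: "'i \<Rightarrow> int \<times> int" and R n :: int
  assumes I: "finite I" "I \<noteq> {}" and inj: "inj_on s I"
    and R: "\<And>i. i \<in> I \<Longrightarrow> \<bar>fst (s i)\<bar> \<le> R \<and> \<bar>snd (s i)\<bar> \<le> R" and n: "4 * R \<le> n"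
    and c: "\<And>i. i \<in> I \<Longrightarrow> c i \<noteq> 0"
    and L: "L = lattice_point \<beta> \<gamma>"
    and rel: "\<And>z. (\<Sum>i\<in>I. c i * cis (Im (cnj (L (s i)) * z)) * G (z - L (s i))) = 0"
    and X: "X = {0..<n} \<times> {0..<n}"
  shows "of_int n ^ 4 * (cmod (G z))\<^sup>2
           \<le> of_int (8 * R * n) * (\<Sum>x\<in>X. \<Sum>y\<in>X. (cmod (G (z + L y - L x)))\<^sup>2)"
proof -
  have R0: "0 \<le> R" using I R by fastforce
  define B where "B = X - {2 * R..<n - 2 * R} \<times> {2 * R..<n - 2 * R}"
  define e where "e i x = c i * cis (Im (cnj (L (s i)) * L x))" for i x
  define H where "H \<mu> w = cis (Im (cnj w * \<mu>)) * G (w - \<mu>)" for \<mu> w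
  \<comment> \<open>\<open>H \<mu>\<close> solves the same relation as \<open>G\<close>; the outer phase in \<open>M\<close> makes its diagonal constant.\<close>
  define M where "M x y = cis (- Im (cnj (L x) * (L x - z))) * H (L x - z) (L y)" for x y
  have fin: "finite X" "finite B" by (auto simp: X B_def)
  \<comment> \<open>Twisted translations with opposite phases commute: the relation for
    \<open>H \<mu>\<close> at \<open>L x\<close> is a unimodular multiple of the one for
    \<open>G\<close> at \<open>L x - \<mu>\<close>.\<close>
  have H: "(\<Sum>i\<in>I. e i x * H \<mu> (L (x - s i))) = 0" for \<mu> x
  proof -
    have "e i x * H \<mu> (L (x - s i)) = cis (Im (cnj (L x) * \<mu>)) *
        (c i * cis (Im (cnj (L (s i)) * (L x - \<mu>))) * G (L x - \<mu> - L (s i)))" for i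
    proof -
      have "cis (Im (cnj (L (s i)) * L x)) * (cis (Im (cnj (L x - L (s i)) * \<mu>)) * v) =
          cis (Im (cnj (L x) * \<mu>)) * (cis (Im (cnj (L (s i)) * (L x - \<mu>))) * v)" for v
        unfolding mult.assoc[symmetric] cis_mult
        by (rule arg_cong[of _ _ "\<lambda>t. cis t * v"]) (simp add: algebra_simps)
      moreover have "L (x - s i) = L x - L (s i)" "L x - L (s i) - \<mu> = L x - \<mu> - L (s i)"
        by (simp_all add: L lattice_point_diff)
      ultimately show ?thesis
        unfolding e_def H_def by (simp only: mult.assoc mult.left_commute[of _ "c i"])
    qed
    then show ?thesis
      by (simp only: rel sum_distrib_left[symmetric] mult_zero_right)
  qed
  have "e i x \<noteq> 0" if "i \<in> I" for i x
    using c[OF that] by (simp add: e_def)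
  then obtain C where C: "\<And>u. \<forall>x. (\<Sum>i\<in>I. e i x * u (x - s i)) = 0 \<Longrightarrow>
      \<forall>y\<in>X. u y = (\<Sum>b\<in>B. C y b * u b)"
    using solutions_determined_on_boundary[OF I inj R _ X B_def, of e] by blast
  have C: "H \<mu> (L y) = (\<Sum>b\<in>B. C y b * H \<mu> (L b))" if "y \<in> X" for \<mu> y
    using C[of "\<lambda>x. H \<mu> (L x)"] H that by blast
  \<comment> \<open>\<open>M\<close> factors through its boundary columns, so its rank is at most
    \<open>card B\<close>.\<close>
  have "M x y = (\<Sum>b\<in>B. M x b * C y b)" if "y \<in> X" for x y
    unfolding M_def C[OF that] sum_distrib_left by (simp only: mult_ac)
  then have "(cmod (\<Sum>x\<in>X. M x x))\<^sup>2 \<le> real (card B) * (\<Sum>x\<in>X. \<Sum>y\<in>X. (cmod (M x y))\<^sup>2)"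
    using fin by (intro trace_sq_le_rank_times_Hilbert_Schmidt[where a = M and v = "\<lambda>b y. C y b"]) auto
  moreover have "M x x = G z" for x
  proof -
    have "M x x = (cis (- Im (cnj (L x) * (L x - z))) * cis (Im (cnj (L x) * (L x - z)))) * G z"
      by (simp add: M_def H_def)
    then show ?thesis by (simp add: cis_mult)
  qed
  moreover have "cmod (M x y) = cmod (G (z + L y - L x))" for x y
    by (simp add: M_def H_def norm_mult algebra_simps)
  moreover have "real (card X) = of_int n ^ 2"
    using n R0 by (simp add: X power2_eq_square)
  ultimately have "of_int n ^ 4 * (cmod (G z))\<^sup>2 \<le> real (card B) * (\<Sum>x\<in>X. \<Sum>y\<in>X. (cmod (G (z + L y - L x)))\<^sup>2)"
    by (simp add: norm_mult power_mult_distrib norm_power flip: power_mult)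
  moreover have "real (card B) \<le> of_int (8 * R * n)"
  proof -
    have "card B = card X - card ({2 * R..<n - 2 * R} \<times> {2 * R..<n - 2 * R})"
      unfolding B_def using R0 by (intro card_Diff_subset) (auto simp: X)
    also have "\<dots> = nat (n * n) - nat ((n - 4 * R) * (n - 4 * R))"
      using n R0 by (simp add: X nat_mult_distrib)
    also have "int \<dots> = n * n - (n - 4 * R) * (n - 4 * R)"
      using n R0 by (subst of_nat_diff) (auto intro!: mult_mono nat_mono)
    also have "\<dots> \<le> 8 * R * n"
      by (simp add: algebra_simps)
    finally show ?thesis by linarith
  qed
  ultimately show ?thesis
    by (meson mult_right_mono order_trans sum_nonneg zero_le_power2)
qed

section \<open>Averaging the box inequality over a small ball\<close>

lemma nn_integral_lborel_translate:
  fixes f :: "'a::euclidean_space \<Rightarrow> ennreal"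
  assumes [measurable]: "f \<in> borel_measurable borel"
  shows "(\<integral>\<^sup>+ x. f (a + x) \<partial>lborel) = (\<integral>\<^sup>+ x. f x \<partial>lborel)"
  by (subst (2) lborel_distr_plus[of a, symmetric]) (simp add: nn_integral_distr)

text \<open>Integrating the box inequality over a ball \<open>D\<close> around a point where
  \<open>G\<close> is nonzero gives a left side of order \<open>n ^ 4\<close> and a right side of
  order \<open>n ^ 3\<close>, which is impossible for large \<open>n\<close>.\<close>

theorem twisted_lattice_translates_independent:
  fixes G :: "complex \<Rightarrow> complex" and c :: "'i \<Rightarrow> complex" and s :: "'i \<Rightarrow> int \<times> int"
  assumes cont: "continuous_on UNIV G"
    and L2: "(\<integral>\<^sup>+ z. ennreal ((cmod (G z))\<^sup>2) \<partial>lborel) < \<infinity>"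
    and indep: "Im (cnj \<beta> * \<gamma>) \<noteq> 0"
    and I: "finite I" "I \<noteq> {}" and inj: "inj_on s I"
    and c: "\<And>i. i \<in> I \<Longrightarrow> c i \<noteq> 0"
    and L: "L = lattice_point \<beta> \<gamma>"
    and rel: "\<And>z. (\<Sum>i\<in>I. c i * cis (Im (cnj (L (s i)) * z)) * G (z - L (s i))) = 0"
  shows "G w = 0"
proof (rule ccontr)
  assume Gw: "G w \<noteq> 0"
  obtain \<delta> where \<delta>: "\<delta> > 0" "\<And>x y. x \<noteq> y \<Longrightarrow> \<delta> \<le> cmod (L x - L y)"
    using lattice_separated[OF indep] unfolding L by metis
  have "isCont G w" using cont by (simp add: continuous_on_eq_continuous_at)
  then obtain \<epsilon> where \<epsilon>: "\<epsilon> > 0" "\<And>z. dist z w < \<epsilon> \<Longrightarrow> dist (G z) (G w) < cmod (G w) / 2"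
    using Gw unfolding continuous_at_eps_delta by (metis half_gt_zero zero_less_norm_iff)
  \<comment> \<open>The bound \<epsilon> keeps \<open>G\<close> away from 0 on \<open>D\<close>; the
    bound \<open>\<delta> / 2\<close> makes the lattice translates of \<open>D\<close>
    disjoint.\<close>
  define D where "D = ball w (min \<epsilon> (\<delta> / 2))"
  define \<phi> where "\<phi> z = ennreal ((cmod (G z))\<^sup>2)" for z
  have [measurable]: "G \<in> borel_measurable borel"
    using cont by (rule borel_measurable_continuous_onI)
  have [measurable]: "\<phi> \<in> borel_measurable borel"
    unfolding \<phi>_def by measurable
  have [measurable]: "D \<in> sets borel" by (simp add: D_def)
  define A where "A = (\<integral>\<^sup>+ z. \<phi> z * indicator D z \<partial>lborel)"
  define J where "J = (\<integral>\<^sup>+ z. \<phi> z \<partial>lborel)"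
  have "A \<le> J" unfolding A_def J_def by (intro nn_integral_mono) (simp add: indicator_def)
  obtain j where j: "J = ennreal j" "0 \<le> j"
    using L2 by (cases J) (auto simp: J_def \<phi>_def)
  then obtain a where a: "A = ennreal a" "0 \<le> a"
    using \<open>A \<le> J\<close> by (cases A) (auto simp: top_unique)
  have "0 < a"
  proof -
    have "ennreal ((cmod (G w) / 2)\<^sup>2) * indicator D z \<le> \<phi> z * indicator D z" for z
    proof (cases "z \<in> D")
      case True
      then have "dist (G z) (G w) < cmod (G w) / 2"
        by (intro \<epsilon>) (simp add: D_def dist_commute)
      then have "cmod (G w) / 2 \<le> cmod (G z)"
        using norm_triangle_ineq2[of "G w" "G z"] by (simp add: dist_norm norm_minus_commute)
      then have "(cmod (G w) / 2)\<^sup>2 \<le> (cmod (G z))\<^sup>2" by (intro power_mono) auto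
      then show ?thesis
        unfolding \<phi>_def by (intro mult_right_mono ennreal_leI) auto
    qed simp
    then have "ennreal ((cmod (G w) / 2)\<^sup>2) * emeasure lborel D \<le> A"
      unfolding A_def by (subst nn_integral_cmult_indicator[symmetric]) (auto intro: nn_integral_mono)
    moreover have "emeasure lborel D > 0"
      unfolding D_def using \<epsilon>(1) \<delta>(1) by (simp add: emeasure_ball)
    moreover have "0 < ennreal ((cmod (G w) / 2)\<^sup>2)"
      using Gw by simp
    ultimately have "A > 0"
      using ennreal_zero_less_mult_iff order_less_le_trans by blast
    then show ?thesis by (simp add: a)
  qed
  obtain R :: int where R: "\<And>i. i \<in> I \<Longrightarrow> \<bar>fst (s i)\<bar> \<le> R \<and> \<bar>snd (s i)\<bar> \<le> R"
  proof
    fix i assume "i \<in> I"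
    then have "\<bar>fst (s i)\<bar> + \<bar>snd (s i)\<bar> \<le> (\<Sum>i\<in>I. \<bar>fst (s i)\<bar> + \<bar>snd (s i)\<bar>)"
      using I by (intro member_le_sum) auto
    then show "\<bar>fst (s i)\<bar> \<le> (\<Sum>i\<in>I. \<bar>fst (s i)\<bar> + \<bar>snd (s i)\<bar>) \<and>
               \<bar>snd (s i)\<bar> \<le> (\<Sum>i\<in>I. \<bar>fst (s i)\<bar> + \<bar>snd (s i)\<bar>)" by linarith
  qed
  then have R0: "0 \<le> R" using I by fastforce
  have bound: "of_int n * a \<le> 8 * of_int R * j" if n: "4 * R \<le> n" "0 < n" for n :: int
  proof -
    define X where "X = {0..<n} \<times> {0..<n}"
    have finX: "finite X" by (simp add: X_def)
    have cardX: "real (card X) = of_int n ^ 2"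
      using n by (simp add: X_def power2_eq_square)
    \<comment> \<open>Moving the translation onto \<open>D\<close> turns the row sum into an
      integral of \<open>\<phi>\<close> over disjoint balls, so no factor \<open>n ^ 2\<close> is
      lost here.\<close>
    have row: "(\<Sum>y\<in>X. \<integral>\<^sup>+ z. \<phi> (z + L y - L x) * indicator D z \<partial>lborel) \<le> J" for x
    proof -
      have "(\<integral>\<^sup>+ z. \<phi> (z + L y - L x) * indicator D z \<partial>lborel) =
            (\<integral>\<^sup>+ z. \<phi> z * indicator D (z - L y + L x) \<partial>lborel)" for y
        by (subst nn_integral_lborel_translate[of "\<lambda>z. \<phi> z * indicator D (z - L y + L x)" "L y - L x", symmetric])
          (simp_all add: algebra_simps)
      then have "(\<Sum>y\<in>X. \<integral>\<^sup>+ z. \<phi> (z + L y - L x) * indicator D z \<partial>lborel) =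
            (\<integral>\<^sup>+ z. \<phi> z * (\<Sum>y\<in>X. indicator D (z - L y + L x)) \<partial>lborel)"
        by (simp add: nn_integral_sum sum_distrib_left)
      also have "\<dots> \<le> J"
        unfolding J_def
      proof (intro nn_integral_mono)
        fix z
        have "(\<Sum>y\<in>X. indicator D (z - L y + L x) :: ennreal) \<le> 1"
        proof (cases "\<exists>y\<in>X. z - L y + L x \<in> D")
          case True
          then obtain y0 where y0: "y0 \<in> X" "z - L y0 + L x \<in> D" by blast
          have "z - L y + L x \<notin> D" if "y \<noteq> y0" for y
          proof
            assume "z - L y + L x \<in> D"
            then have "dist (z - L y + L x) (z - L y0 + L x) < \<delta> / 2 + \<delta> / 2"
              using y0(2) unfolding D_def by (intro dist_triangle_less_add[of _ w]) (auto simp: dist_commute)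
            then show False using \<delta>(2)[of y0 y] that by (simp add: dist_norm)
          qed
          then have "(\<Sum>y\<in>X. indicator D (z - L y + L x) :: ennreal) = (\<Sum>y\<in>X. if y = y0 then 1 else 0)"
            using y0 by (intro sum.cong) (auto simp: indicator_def)
          then show ?thesis using finX y0 by simp
        next
          case False
          then show ?thesis by simp
        qed
        then show "\<phi> z * (\<Sum>y\<in>X. indicator D (z - L y + L x)) \<le> \<phi> z"
          using mult_left_mono[of "\<Sum>y\<in>X. indicator D (z - L y + L x)" 1 "\<phi> z"] by simp
      qed
      finally show ?thesis .
    qed
    have pt: "ennreal (of_int n ^ 4) * \<phi> z \<le> ennreal (of_int (8 * R * n)) * (\<Sum>x\<in>X. \<Sum>y\<in>X. \<phi> (z + L y - L x))" for z
    proof -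
      have "(\<Sum>x\<in>X. \<Sum>y\<in>X. \<phi> (z + L y - L x)) = ennreal (\<Sum>x\<in>X. \<Sum>y\<in>X. (cmod (G (z + L y - L x)))\<^sup>2)"
        unfolding \<phi>_def by (simp add: sum_ennreal sum_nonneg)
      then show ?thesis
        using box_inequality[OF I inj R n(1) c L rel X_def, of z] n R0
        by (simp add: \<phi>_def ennreal_leI sum_nonneg flip: ennreal_mult)
    qed
    have "ennreal (of_int n ^ 4) * A = (\<integral>\<^sup>+ z. ennreal (of_int n ^ 4) * \<phi> z * indicator D z \<partial>lborel)"
      unfolding A_def by (simp add: nn_integral_cmult mult.assoc)
    also have "\<dots> \<le> (\<integral>\<^sup>+ z. ennreal (of_int (8 * R * n)) * (\<Sum>x\<in>X. \<Sum>y\<in>X. \<phi> (z + L y - L x)) * indicator D z \<partial>lborel)"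
      by (intro nn_integral_mono mult_right_mono pt) auto
    also have "\<dots> = ennreal (of_int (8 * R * n)) * (\<Sum>x\<in>X. \<Sum>y\<in>X. \<integral>\<^sup>+ z. \<phi> (z + L y - L x) * indicator D z \<partial>lborel)"
      by (simp add: nn_integral_cmult nn_integral_sum sum_distrib_right mult.assoc)
    also have "\<dots> \<le> ennreal (of_int (8 * R * n)) * (\<Sum>x\<in>X. J)"
      by (intro mult_left_mono sum_mono row) auto
    also have "\<dots> = ennreal (of_int (8 * R * n) * (of_int n ^ 2 * j))"
      using n R0 by (simp add: j cardX ennreal_mult ennreal_of_nat_eq_real_of_nat)
    finally have "of_int n ^ 4 * a \<le> of_int (8 * R * n) * (of_int n ^ 2 * j)"
      using n R0 a j by (simp add: ennreal_le_iff flip: ennreal_mult)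
    then have "of_int n ^ 3 * (of_int n * a) \<le> of_int n ^ 3 * (8 * of_int R * j)"
      by (simp add: power2_eq_square power3_eq_cube power4_eq_xxxx mult_ac)
    then show ?thesis
      by (rule mult_left_le_imp_le) (use n in simp)
  qed
  obtain m :: int where m: "8 * of_int R * j / a < of_int m"
    using ex_less_of_int by blast
  \<comment> \<open>\<open>m\<close> exceeds the limit that \<open>bound\<close> puts on
    \<open>n\<close>; \<open>4 * R\<close> and 1 are there to meet its premises.\<close>
  define n where "n = max m (max (4 * R) 1)"
  have "8 * of_int R * j < of_int m * a"
    using m \<open>0 < a\<close> by (simp add: pos_divide_less_eq)
  also have "\<dots> \<le> of_int n * a"
    using \<open>0 < a\<close> by (intro mult_right_mono) (auto simp: n_def)
  also have "\<dots> \<le> 8 * of_int R * j"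
    by (rule bound) (auto simp: n_def)
  finally show False by simp
qed

section \<open>Entire functions and rotations\<close>

lemma entire_power_series_0:
  assumes "f holomorphic_on UNIV"
  shows "(\<lambda>n. (deriv ^^ n) f 0 / fact n * z ^ n) sums f z"
  using holomorphic_power_series[of f 0 "cmod z + 1" z] assms
  by (auto intro: holomorphic_on_subset)

text \<open>In the power series, summing over rotations kills every exponent not divisible by
  \<open>d\<close> (a geometric sum of roots of unity), and \<open>vanish\<close> kills the
  others.\<close>

lemma rotation_sum_eq_0:
  assumes f: "f holomorphic_on UNIV"
    and \<omega>: "\<And>n. \<omega> ^ n = 1 \<longleftrightarrow> d dvd n"
    and vanish: "\<And>n. d dvd n \<Longrightarrow> (deriv ^^ n) f 0 = 0"
  shows "(\<Sum>m<d. f (\<omega> ^ m * z)) = 0"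
proof -
  have "(\<lambda>n. \<Sum>m<d. (deriv ^^ n) f 0 / fact n * (\<omega> ^ m * z) ^ n) sums (\<Sum>m<d. f (\<omega> ^ m * z))"
    by (intro sums_sum entire_power_series_0 f)
  moreover have "(\<Sum>m<d. (deriv ^^ n) f 0 / fact n * (\<omega> ^ m * z) ^ n) = 0" for n
  proof (cases "d dvd n")
    case True
    then show ?thesis by (simp add: vanish)
  next
    case False
    have "(\<omega> ^ n) ^ d = 1"
      using \<omega>[of "n * d"] by (simp flip: power_mult)
    then have "(\<Sum>m<d. (\<omega> ^ n) ^ m) = 0"
      using False \<omega>[of n] by (simp add: geometric_sum)
    moreover have "(\<Sum>m<d. (deriv ^^ n) f 0 / fact n * (\<omega> ^ m * z) ^ n)
        = (deriv ^^ n) f 0 / fact n * z ^ n * (\<Sum>m<d. (\<omega> ^ n) ^ m)"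
      unfolding sum_distrib_left
      by (intro sum.cong refl) (simp add: power_mult_distrib mult.commute[of _ n] flip: power_mult)
    ultimately show ?thesis by simp
  qed
  ultimately have "(\<lambda>n. 0) sums (\<Sum>m<d. f (\<omega> ^ m * z))"
    by (simp only:)
  then show ?thesis
    by (rule sums_unique2) (rule sums_zero)
qed

lemma rotation_invariant:
  assumes g: "g holomorphic_on UNIV" and \<omega>: "\<omega> ^ d = 1"
    and vanish: "\<And>n. \<not> d dvd n \<Longrightarrow> (deriv ^^ n) g 0 = 0"
  shows "g (\<omega> * z) = g z"
proof -
  have "(deriv ^^ n) g 0 / fact n * (\<omega> * z) ^ n = (deriv ^^ n) g 0 / fact n * z ^ n" for n
  proof (cases "d dvd n")
    case True
    then have "\<omega> ^ n = 1" using \<omega> by (auto simp: power_mult)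
    then show ?thesis by (simp add: power_mult_distrib)
  qed (simp add: vanish)
  then show ?thesis
    using sums_unique2[OF entire_power_series_0[OF g, of "\<omega> * z"]] entire_power_series_0[OF g, of z]
    by (simp only:)
qed

text \<open>The crystallographic restriction: for these \<open>d\<close> the cyclotomic polynomial
  is quadratic, so every power of \<eta> is an integer combination of 1 and \<eta>. Entry
  \<open>m\<close> of \<open>ss\<close> holds the coordinates of \<open>\<eta> ^ m\<close>.\<close>

lemma primitive_root_orbit_in_lattice:
  fixes \<eta> :: complex
  assumes "d \<in> {3, 4, 6}" and prim: "\<And>n. \<eta> ^ n = 1 \<longleftrightarrow> d dvd n"
  obtains ss where "distinct ss" "length ss = d"
    "\<And>m. m < d \<Longrightarrow> lattice_point \<beta> (\<eta> * \<beta>) (ss ! m) = \<eta> ^ m * \<beta>"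
proof -
  consider "d = 3" | "d = 4" | "d = 6" using assms(1) by blast
  then show ?thesis
  proof cases
    case 1
    \<comment> \<open>In each case \<open>prim\<close> excludes the factors of
      \<open>\<eta> ^ d - 1\<close> whose roots have smaller order, leaving the cyclotomic
      one.\<close>
    have "(\<eta> - 1) * (\<eta> ^ 2 + \<eta> + 1) = 0"
      using prim[of 3] 1 by (simp add: algebra_simps power2_eq_square power3_eq_cube)
    then have "\<eta> ^ 2 + \<eta> + 1 = 0" using prim[of 1] 1 by simp
    then have "\<eta> ^ 2 = - \<eta> - 1" by algebra
    then have "lattice_point \<beta> (\<eta> * \<beta>) ([(1, 0), (0, 1), (-1, -1)] ! m) = \<eta> ^ m * \<beta>" if "m \<in> {0, 1, 2}" for m
      using that by (auto simp: lattice_point_def left_diff_distrib)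
    moreover have "m \<in> {0, 1, 2}" if "m < 3" for m :: nat using that by auto
    ultimately show ?thesis
      by (intro that[of "[(1, 0), (0, 1), (-1, -1)]"]) (simp_all add: 1)
  next
    case 2
    have "(\<eta> ^ 2 - 1) * (\<eta> ^ 2 + 1) = 0"
      using prim[of 4] 2 by (simp add: algebra_simps flip: power_add)
    then have p2: "\<eta> ^ 2 = - 1" using prim[of 2] 2 by (simp add: eq_neg_iff_add_eq_0)
    have p3: "\<eta> ^ 3 = - \<eta>" using p2 by algebra
    have "lattice_point \<beta> (\<eta> * \<beta>) ([(1, 0), (0, 1), (-1, 0), (0, -1)] ! m) = \<eta> ^ m * \<beta>" if "m \<in> {0, 1, 2, 3}" for m
      using that p2 p3 by (auto simp: lattice_point_def)
    moreover have "m \<in> {0, 1, 2, 3}" if "m < 4" for m :: nat using that by auto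
    ultimately show ?thesis
      by (intro that[of "[(1, 0), (0, 1), (-1, 0), (0, -1)]"]) (simp_all add: 2)
  next
    case 3
    have "(\<eta> ^ 3 - 1) * (\<eta> ^ 3 + 1) = 0"
      using prim[of 6] 3 by (simp add: algebra_simps flip: power_add)
    then have p3: "\<eta> ^ 3 = - 1" using prim[of 3] 3 by (simp add: eq_neg_iff_add_eq_0)
    then have "(\<eta> + 1) * (\<eta> ^ 2 - \<eta> + 1) = 0" by algebra
    moreover have "\<eta> + 1 \<noteq> 0"
      using prim[of 2] 3 by (auto simp: add_eq_0_iff2)
    ultimately have "\<eta> ^ 2 - \<eta> + 1 = 0" by simp
    then have p2: "\<eta> ^ 2 = \<eta> - 1" by algebra
    have p4: "\<eta> ^ 4 = - \<eta>" and p5: "\<eta> ^ 5 = 1 - \<eta>" using p2 p3 by algebra+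
    have "lattice_point \<beta> (\<eta> * \<beta>) ([(1, 0), (0, 1), (-1, 1), (-1, 0), (0, -1), (1, -1)] ! m) = \<eta> ^ m * \<beta>" if "m \<in> {0, 1, 2, 3, 4, 5}" for m
      using that p2 p3 p4 p5 by (auto simp: lattice_point_def left_diff_distrib)
    moreover have "m \<in> {0, 1, 2, 3, 4, 5}" if "m < 6" for m :: nat using that by auto
    ultimately show ?thesis
      by (intro that[of "[(1, 0), (0, 1), (-1, 1), (-1, 0), (0, -1), (1, -1)]"]) (simp_all add: 3)
  qed
qed

text \<open>The exponential in \<open>weyl\<close> completes the square in
  \<open>(cmod (\<beta> + z))\<^sup>2\<close>. With the Gaussian absorbed, the Weyl operator is a
  translation up to phase, and membership in the Fock space becomes square integrability.\<close>

lemma weyl_gaussian: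
  "(cmod (exp (- of_real ((cmod z)\<^sup>2) / 2) * weyl \<beta> f z))\<^sup>2 =
     (cmod (f (\<beta> + z)))\<^sup>2 * exp (- (cmod (\<beta> + z))\<^sup>2)"
proof -
  have "(cmod (\<beta> + z))\<^sup>2 = (cmod \<beta>)\<^sup>2 + (cmod z)\<^sup>2 + 2 * Re (cnj \<beta> * z)"
    unfolding cmod_power2 by (simp add: power2_eq_square algebra_simps)
  then show ?thesis
    by (simp add: weyl_def norm_mult power_mult_distrib add.commute norm_exp_eq_Re
        flip: exp_double exp_add)
qed

lemma borel_measurable_gaussian_weight:
  assumes "f holomorphic_on UNIV"
  shows "(\<lambda>z. (cmod (f z))\<^sup>2 * exp (- (cmod z)\<^sup>2)) \<in> borel_measurable borel"
  using holomorphic_on_imp_continuous_on[OF assms]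
  by (intro borel_measurable_continuous_onI continuous_intros)

lemma fock_nn_integral_lborel_finite:
  assumes "f \<in> fock_space"
  shows "(\<integral>\<^sup>+ z. ennreal ((cmod (f z))\<^sup>2 * exp (- (cmod z)\<^sup>2)) \<partial>lborel) < \<infinity>"
proof -
  have "(\<lambda>z. (cmod (f z))\<^sup>2 * exp (- (cmod z)\<^sup>2)) \<in> borel_measurable borel"
    using assms by (intro borel_measurable_gaussian_weight) (simp add: fock_space_def)
  then have "fock_norm_sq f = ennreal (1 / pi) *
      (\<integral>\<^sup>+ z. ennreal ((cmod (f z))\<^sup>2 * exp (- (cmod z)\<^sup>2)) \<partial>lborel)"
    unfolding fock_norm_sq_def area_measure_def by (intro nn_integral_scale_measure) simp
  then show ?thesis
    using assms by (auto simp: fock_space_def ennreal_mult_less_top)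
qed

section \<open>Reduction to the independence of lattice translates\<close>

theorem mainTheorem1:
  fixes d :: nat and f :: "complex \<Rightarrow> complex"
  assumes "d \<in> {3, 4, 6}"
    and "f \<in> fock_space"
    and "\<exists>\<beta>. (\<forall>j \<in> progression d 0. (deriv ^^ j) f 0 = 0) \<and>
             (\<forall>k \<in> {1..d - 1}. \<forall>j \<in> progression d k. (deriv ^^ j) (weyl \<beta> f) 0 = 0)"
  shows "f = (\<lambda>z. 0)"
proof -
  obtain \<beta> where f0: "\<And>j. j \<in> progression d 0 \<Longrightarrow> (deriv ^^ j) f 0 = 0"
    and g0: "\<And>k j. k \<in> {1..d - 1} \<Longrightarrow> j \<in> progression d k \<Longrightarrow> (deriv ^^ j) (weyl \<beta> f) 0 = 0"
    using assms(3) by blast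
  have d: "d > 2" using assms(1) by auto
  define g where "g = weyl \<beta> f"
  have f: "f holomorphic_on UNIV" using assms(2) by (simp add: fock_space_def)
  have "(f \<circ> (\<lambda>z. z + \<beta>)) holomorphic_on UNIV"
    by (intro holomorphic_on_compose_gen[OF _ f]) (auto intro!: holomorphic_intros)
  then have g: "g holomorphic_on UNIV"
    unfolding g_def weyl_def o_def by (intro holomorphic_intros)
  have fn: "(deriv ^^ n) f 0 = 0" if "d dvd n" for n
    using that by (intro f0) (auto simp: progression_def)
  have gn: "(deriv ^^ n) g 0 = 0" if "\<not> d dvd n" for n
    unfolding g_def
  proof (rule g0)
    show "n mod d \<in> {1..d - 1}"
      using that d mod_less_divisor[of d n] by (auto simp: dvd_eq_mod_eq_0 simp del: mod_less_divisor)
    show "n \<in> progression d (n mod d)"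
      unfolding progression_def by (auto intro!: exI[of _ "n div d"])
  qed
  define \<omega> where "\<omega> = exp (2 * of_real pi * \<i> / of_nat d)"
  have \<omega>: "\<omega> ^ n = 1 \<longleftrightarrow> d dvd n" for n
    using complex_root_unity_eq_1[of d n] d
    by (simp add: \<omega>_def mult_ac flip: exp_of_nat_mult)
  \<comment> \<open>The inverse of \<omega>: rotating the argument of \<open>f\<close> by
    \<open>\<omega> ^ m\<close> translates \<open>g\<close> by \<open>\<eta> ^ m * \<beta>\<close>,
    because \<open>\<omega> ^ m * z - \<beta> = \<omega> ^ m * (z - \<eta> ^ m *
    \<beta>)\<close>.\<close>
  define \<eta> where "\<eta> = cnj \<omega>"
  have \<eta>: "\<eta> ^ n = 1 \<longleftrightarrow> d dvd n" for n
    unfolding \<eta>_def \<omega>[symmetric] by (metis complex_cnj_cnj complex_cnj_one complex_cnj_power)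
  have norm\<omega>: "cmod \<omega> = 1"
    by (simp add: \<omega>_def norm_exp_eq_Re)
  have "\<omega> * \<eta> = of_real ((cmod \<omega>)\<^sup>2)"
    by (simp only: complex_norm_square \<eta>_def)
  then have \<omega>\<eta>: "\<omega> * \<eta> = 1"
    by (simp add: norm\<omega>)
  have inv: "g (\<omega> ^ m * z) = g z" for m z
  proof (induction m)
    case (Suc m)
    then show ?case
      using rotation_invariant[OF g _ gn, where \<omega> = \<omega> and z = "\<omega> ^ m * z"] \<omega>[of d] by (simp add: mult.assoc)
  qed simp
  \<comment> \<open>The Weyl operator inverted; it rewrites the rotates of \<open>f\<close> in terms
    of \<open>g\<close> and finally gives \<open>f = 0\<close> from \<open>g = 0\<close>.\<close>
  have f_eq: "f w = exp (of_real ((cmod \<beta>)\<^sup>2) / 2 + cnj \<beta> * (w - \<beta>)) * g (w - \<beta>)" for w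
    by (simp add: g_def weyl_def mult.assoc[symmetric] flip: exp_add)
  have "g z = 0" for z
  proof (cases "\<beta> = 0")
    \<comment> \<open>The lattice degenerates, but then the two sets of conditions concern the same
      function and cover all its Taylor coefficients.\<close>
    case True
    then have "f = g" by (simp add: g_def weyl_def)
    then have "(deriv ^^ n) g 0 = 0" for n using fn gn by blast
    then show ?thesis
      using entire_power_series_0[OF g, of z] by (simp add: sums_0 sums_unique2[of _ _ 0])
  next
    case False
    define G where "G z = exp (- of_real ((cmod z)\<^sup>2) / 2) * g z" for z
    obtain ss where ss: "distinct ss" "length ss = d"
      and orbit: "\<And>m. m < d \<Longrightarrow> lattice_point \<beta> (\<eta> * \<beta>) (ss ! m) = \<eta> ^ m * \<beta>"
      using primitive_root_orbit_in_lattice[OF assms(1) \<eta>] by blast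
    have norm\<eta>: "cmod \<eta> = 1" by (simp add: \<eta>_def norm\<omega>)
    have "G z = 0"
    proof (rule twisted_lattice_translates_independent[where I = "{..<d}" and s = "(!) ss" and c = "\<lambda>_. 1"
          and G = G and \<beta> = \<beta> and \<gamma> = "\<eta> * \<beta>" and L = "lattice_point \<beta> (\<eta> * \<beta>)"])
      show "continuous_on UNIV G"
        unfolding G_def using holomorphic_on_imp_continuous_on[OF g] by (intro continuous_intros) auto
      have "(\<integral>\<^sup>+ z. ennreal ((cmod (G z))\<^sup>2) \<partial>lborel) =
          (\<integral>\<^sup>+ z. ennreal ((cmod (f z))\<^sup>2 * exp (- (cmod z)\<^sup>2)) \<partial>lborel)"
        unfolding G_def g_def weyl_gaussian
        using borel_measurable_gaussian_weight[OF f]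
        by (intro nn_integral_lborel_translate[of "\<lambda>z. ennreal ((cmod (f z))\<^sup>2 * exp (- (cmod z)\<^sup>2))"]) simp
      then show "(\<integral>\<^sup>+ z. ennreal ((cmod (G z))\<^sup>2) \<partial>lborel) < \<infinity>"
        using fock_nn_integral_lborel_finite[OF assms(2)] by simp
      \<comment> \<open>Otherwise \<eta> would be real of modulus 1, hence of order at most 2,
        against \<open>d > 2\<close>.\<close>
      show "Im (cnj \<beta> * (\<eta> * \<beta>)) \<noteq> 0"
      proof
        assume "Im (cnj \<beta> * (\<eta> * \<beta>)) = 0"
        moreover have "cnj \<beta> * (\<eta> * \<beta>) = of_real ((cmod \<beta>)\<^sup>2) * \<eta>"
          unfolding complex_norm_square by simp
        ultimately have "Im \<eta> = 0" using False by simp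
        then have "\<eta> ^ 2 = of_real ((cmod \<eta>)\<^sup>2)"
          unfolding cmod_power2 by (simp add: complex_eq_iff power2_eq_square)
        then have "\<eta> ^ 2 = 1" using norm\<eta> by simp
        then show False using \<eta>[of 2] d by (auto dest: dvd_imp_le)
      qed
      show "finite {..<d}" "{..<d} \<noteq> {}" using d by auto
      show "inj_on ((!) ss) {..<d}" using ss by (auto intro: inj_on_nth)
      show "(\<Sum>m<d. 1 * cis (Im (cnj (lattice_point \<beta> (\<eta> * \<beta>) (ss ! m)) * z)) *
               G (z - lattice_point \<beta> (\<eta> * \<beta>) (ss ! m))) = 0" for z
      proof -
        \<comment> \<open>The common nonzero factor of all rotates of \<open>f\<close> at
          \<open>z\<close>. It is independent of \<open>m\<close> since all orbit points have
          modulus \<open>cmod \<beta>\<close>.\<close>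
        define K where "K = exp (of_real ((cmod \<beta>)\<^sup>2) / 2 - cnj \<beta> * \<beta> + of_real ((cmod z)\<^sup>2 + (cmod \<beta>)\<^sup>2) / 2)"
        have "f (\<omega> ^ m * z) = K * (1 * cis (Im (cnj (lattice_point \<beta> (\<eta> * \<beta>) (ss ! m)) * z)) *
               G (z - lattice_point \<beta> (\<eta> * \<beta>) (ss ! m)))" if "m < d" for m
        proof -
          define \<alpha> where "\<alpha> = \<eta> ^ m * \<beta>"
          have "\<omega> ^ m * \<alpha> = (\<omega> * \<eta>) ^ m * \<beta>"
            by (simp add: \<alpha>_def power_mult_distrib)
          then have "\<omega> ^ m * z - \<beta> = \<omega> ^ m * (z - \<alpha>)"
            using \<omega>\<eta> by (simp add: right_diff_distrib)
          then have "g (\<omega> ^ m * z - \<beta>) = g (z - \<alpha>)" by (simp add: inv)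
          moreover have "g (z - \<alpha>) = exp (of_real ((cmod (z - \<alpha>))\<^sup>2) / 2) * G (z - \<alpha>)"
            by (simp add: G_def mult.assoc[symmetric] flip: exp_add)
          ultimately have "f (\<omega> ^ m * z) =
              exp (of_real ((cmod \<beta>)\<^sup>2) / 2 + cnj \<beta> * (\<omega> ^ m * z - \<beta>) + of_real ((cmod (z - \<alpha>))\<^sup>2) / 2) * G (z - \<alpha>)"
            by (simp add: f_eq exp_add mult.assoc)
          \<comment> \<open>The real part of \<open>cnj \<alpha> * z\<close> cancels against the
            cross term of \<open>(cmod (z - \<alpha>))\<^sup>2 / 2\<close>, so only a phase still
            depends on \<open>m\<close>.\<close>
          also have "of_real ((cmod \<beta>)\<^sup>2) / 2 + cnj \<beta> * (\<omega> ^ m * z - \<beta>) + of_real ((cmod (z - \<alpha>))\<^sup>2) / 2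
              = (of_real ((cmod \<beta>)\<^sup>2) / 2 - cnj \<beta> * \<beta> + of_real ((cmod z)\<^sup>2 + (cmod \<beta>)\<^sup>2) / 2) + \<i> * of_real (Im (cnj \<alpha> * z))"
          proof -
            define p where "p = cnj \<alpha> * z"
            have 1: "cnj \<beta> * (\<omega> ^ m * z - \<beta>) = p - cnj \<beta> * \<beta>"
              by (simp add: p_def \<alpha>_def \<eta>_def right_diff_distrib)
            have "cmod \<alpha> = cmod \<beta>"
              by (simp add: \<alpha>_def norm_mult norm_power norm\<eta>)
            moreover have "(cmod (z - \<alpha>))\<^sup>2 = (cmod z)\<^sup>2 + (cmod \<alpha>)\<^sup>2 - 2 * Re p"
              unfolding cmod_power2 by (simp add: p_def power2_eq_square algebra_simps)
            ultimately have 2: "(cmod (z - \<alpha>))\<^sup>2 = (cmod z)\<^sup>2 + (cmod \<beta>)\<^sup>2 - 2 * Re p"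
              by simp
            show ?thesis
              unfolding 1 2 p_def[symmetric] complex_eq_iff
              by (simp add: diff_divide_distrib del: of_real_power)
          qed
          finally show ?thesis
            by (simp add: K_def orbit[OF that] \<alpha>_def[symmetric] exp_add cis_conv_exp)
        qed
        then have "K * (\<Sum>m<d. 1 * cis (Im (cnj (lattice_point \<beta> (\<eta> * \<beta>) (ss ! m)) * z)) *
               G (z - lattice_point \<beta> (\<eta> * \<beta>) (ss ! m))) = (\<Sum>m<d. f (\<omega> ^ m * z))"
          unfolding sum_distrib_left by (intro sum.cong) auto
        then show ?thesis
          using rotation_sum_eq_0[OF f \<omega> fn] by (simp add: K_def)
      qed
    qed auto
    then show ?thesis by (simp add: G_def)
  qed
  then show ?thesis by (simp add: f_eq fun_eq_iff)
qed

end
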